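(* Let $\eta\in\mathcal{C}_r$ be a local configuration of radius $r$. Assume that $a(n)<0$, $b(n)\ge0$, and that $$n^d\,W_n(\eta)=\lambda$$ for some constant $\lambda>0$ (independent of $n$). Then: (1) If $a(n)+2\mathcal{V}\,b(n)\le 0$ for all $n$ large enough, then for every finite set of vertices $V\subset V_n$ there exist $N(V)\in\mathbb{N}$ and a constant $C=C(|V|)>0$, depending on $V$ only through its cardinality, such that for all $\zeta\in\{-,+\}^V$ and all $n\ge N(V)$, $$\mu_{a,b}(I_V^\zeta=1)\le C\,W_n(\zeta).$$ (2) If $\displaystyle\lim_{n\to+\infty}\big(a(n)+\mathcal{V}\,b(n)\big)=-\infty$, then $$\lim_{n\to+\infty}\max\{\Delta_n(\eta),\Theta_n(\eta)\}=0.$$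
   Context: Graph. Fix $d\ge 1$, $1\le p\le\infty$ and a parameter $\rho\ge 1$. For an integer $n$ let $G_n=(V_n,E_n)$ be the lattice torus with vertex set $V_n=\{0,\dots,n-1\}^d$, where $\{x,y\}\in E_n$ iff $x\ne y$ and $\|y-x\|_p\le\rho$, the subtraction being taken componentwise modulo $n$ (representatives of smallest absolute value). All operations on vertices are modulo $n$. Every vertex has the same number $\mathcal{V}$ of neighbors. $\mathrm{dist}$ is the graph distance and $B(x,r)=\{y\in V_n:\mathrm{dist}(x,y)\le r\}$. For $V\subset V_n$, $\delta V=\{y\in V_n\setminus V:\exists x\in V,\ \{x,y\}\in E_n\}$. The positive integer $r$ is fixed (independent of $n$), and it is always assumed that $n>2\rho r$. Ising model. $\mathcal{X}_n=\{-1,+1\}^{V_n}$; the states $\pm1$ are written $+$ and $-$. Given reals $a=a(n)$ (magnetic field) and $b=b(n)$ (pair potential), $\mu_{a,b}=\mu_{a(n),b(n)}$ is the probability measure on $\mathcal{X}_n$ $$\mu_{a,b}(\sigma)=\frac1{Z_{a,b}}\exp\Big(a\sum_{x\in V_n}\sigma(x)+b\sum_{\{x,y\}\in E_n}\sigma(x)\sigma(y)\Big).$$ Configurations and weights. For $V\subset V_n$ and $\zeta\in\{-,+\}^V$: $V_+(\zeta)=\{x\in V:\zeta(x)=+\}$, $k(\zeta)=|V_+(\zeta)|$, the perimeter is $\gamma(\zeta)=\mathcal{V}\,|V_+(\zeta)|-2\,|\{\{x,y\}\in E_n: x,y\in V_+(\zeta)\}|$, and the weight is $W_n(\zeta)=\exp(2a(n)k(\zeta)-2b(n)\gamma(\zeta))$.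 The configuration with no positive vertex is called null. If $V,V'$ are disjoint, $\zeta\zeta'$ denotes the configuration on $V\cup V'$ equal to $\zeta$ on $V$ and $\zeta'$ on $V'$. $I_V^\zeta:\mathcal{X}_n\to\{0,1\}$ is the indicator that the restriction of $\sigma$ to $V$ equals $\zeta$. Local configurations. $\mathcal{C}_r=\{-,+\}^{B(0,r)}$ is the set of local configurations of radius $r$ (for large $n$ the balls $B(0,r)$ in the different $G_n$ are identified). For $\eta\in\mathcal{C}_r$ and $x\in V_n$, $\eta_x\in\{-,+\}^{B(x,r)}$ is the translate $\eta_x(x+y)=\eta(y)$. Probability gap: with $B=B(x,r)$ for any $x\in V_n$ (the value does not depend on $x$) and $\sigma^0$ the null configuration on $\delta B$, $$\Delta_n(\eta)=\max_{\sigma\in\{-,+\}^{\delta B},\,\sigma\ne\sigma^0}\frac{W_n(\eta_x\sigma)}{W_n(\eta)}.$$ Maximality probability: with $\mathcal{C}_r(\eta)=\{\eta'\in\mathcal{C}_r:V_+(\eta')\supset V_+(\eta)\}$ and $\mathcal{C}_r^*(\eta)=\mathcal{C}_r(\eta)\setminus\{\eta\}$, $$\Theta_n(\eta)=\max_{\eta'\in\mathcal{C}_r^*(\eta)}\frac{W_n(\eta')}{W_n(\eta)}$$ (a maximum over the empty set is $0$). *)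

theory Defs
  imports "HOL-Probability.Probability"
begin

section \<open>Graphs given by their edge sets\<close>

text \<open>
  A graph is represented by its set of edges, an edge being a two-element set of vertices.
  Distances are extended naturals, the distance between unconnected vertices being \<open>\<infinity>\<close>.
\<close>

definition graph_dist :: "'a set set \<Rightarrow> 'a \<Rightarrow> 'a \<Rightarrow> enat" where
  "graph_dist E x y = (INF k\<in>{k. (x, y) \<in> {(u, v). {u, v} \<in> E} ^^ k}. enat k)"

definition graph_ball :: "'a set \<Rightarrow> 'a set set \<Rightarrow> 'a \<Rightarrow> nat \<Rightarrow> 'a set" where
  "graph_ball X E x r = {y \<in> X. graph_dist E x y \<le> enat r}"

definition outer_boundary :: "'a set \<Rightarrow> 'a set set \<Rightarrow> 'a set \<Rightarrow> 'a set" where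
  "outer_boundary X E V = {y \<in> X - V. \<exists>x\<in>V. {x, y} \<in> E}"


section \<open>The lattice torus\<close>

text \<open>
  Vertices live in \<open>int ^ 'd\<close>, so that the dimension is \<open>CARD('d) \<ge> 1\<close>.  The exponent \<open>p\<close> is an
  extended real, to be used with \<open>1 \<le> p \<le> \<infinity>\<close>.
\<close>

definition lp_norm :: "ereal \<Rightarrow> int ^ 'd::finite \<Rightarrow> real" where
  "lp_norm p x =
     (if p = \<infinity> then Max (range (\<lambda>i. real_of_int \<bar>x $ i\<bar>))
      else (\<Sum>i\<in>UNIV. real_of_int \<bar>x $ i\<bar> powr real_of_ereal p) powr (1 / real_of_ereal p))"

definition torus_verts :: "nat \<Rightarrow> (int ^ 'd::finite) set" where
  "torus_verts n = {x. \<forall>i. x $ i \<in> {0..<int n}}"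

text \<open>
  Reduction modulo \<open>n\<close>.  A finite set \<open>V\<close> of integer vectors that does not depend on \<open>n\<close> is seen as a
  set of vertices of the torus through \<open>wrap n ` V\<close>; this is \<open>V\<close> itself if \<open>V \<subseteq> torus_verts n\<close>.
\<close>

definition wrap :: "nat \<Rightarrow> int ^ 'd::finite \<Rightarrow> int ^ 'd" where
  "wrap n x = (\<chi> i. x $ i mod int n)"

text \<open>The componentwise representative modulo \<open>n\<close> of smallest absolute value.\<close>

definition central_rep :: "nat \<Rightarrow> int ^ 'd::finite \<Rightarrow> int ^ 'd" where
  "central_rep n x =
     (\<chi> i. if 2 * (x $ i mod int n) \<le> int n then x $ i mod int n else x $ i mod int n - int n)"

definition torus_edges :: "ereal \<Rightarrow> real \<Rightarrow> nat \<Rightarrow> (int ^ 'd::finite) set set" where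
  "torus_edges p \<rho> n =
     {{x, y} | x y. x \<in> torus_verts n \<and> y \<in> torus_verts n \<and> x \<noteq> y \<and>
                    lp_norm p (central_rep n (y - x)) \<le> \<rho>}"

definition torus_ball :: "ereal \<Rightarrow> real \<Rightarrow> nat \<Rightarrow> int ^ 'd::finite \<Rightarrow> nat \<Rightarrow> (int ^ 'd) set" where
  "torus_ball p \<rho> n x r = graph_ball (torus_verts n) (torus_edges p \<rho> n) x r"

definition torus_boundary :: "ereal \<Rightarrow> real \<Rightarrow> nat \<Rightarrow> (int ^ 'd::finite) set \<Rightarrow> (int ^ 'd) set" where
  "torus_boundary p \<rho> n V = outer_boundary (torus_verts n) (torus_edges p \<rho> n) V"

text \<open>
  The common number of neighbours of all vertices, read off at the origin.  The type argument
  provides the dimension.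
\<close>

definition torus_degree :: "'d::finite itself \<Rightarrow> ereal \<Rightarrow> real \<Rightarrow> nat \<Rightarrow> nat" where
  "torus_degree _ p \<rho> n =
     card {y :: int ^ 'd. y \<in> torus_verts n \<and> {0, y} \<in> torus_edges p \<rho> n}"


section \<open>Configurations, weights and the Ising measure\<close>

text \<open>
  States are the reals \<open>1\<close> and \<open>-1\<close>; configurations on \<open>V\<close> are extensional functions, so that
  they are determined by their values on \<open>V\<close>.
\<close>

definition configs :: "'a set \<Rightarrow> ('a \<Rightarrow> real) set" where
  "configs V = (V \<rightarrow>\<^sub>E {-1, 1})"

definition null_config :: "'a set \<Rightarrow> 'a \<Rightarrow> real" where
  "null_config V = (\<lambda>x\<in>V. -1)"

definition pos_verts :: "'a set \<Rightarrow> ('a \<Rightarrow> real) \<Rightarrow> 'a set" where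
  "pos_verts V \<zeta> = {x \<in> V. \<zeta> x = 1}"

definition config_indicator :: "'a set \<Rightarrow> ('a \<Rightarrow> real) \<Rightarrow> ('a \<Rightarrow> real) \<Rightarrow> nat" where
  "config_indicator V \<zeta> \<sigma> = (if restrict \<sigma> V = \<zeta> then 1 else 0)"

definition perimeter ::
    "ereal \<Rightarrow> real \<Rightarrow> nat \<Rightarrow> (int ^ 'd::finite) set \<Rightarrow> (int ^ 'd \<Rightarrow> real) \<Rightarrow> real" where
  "perimeter p \<rho> n V \<zeta> =
     real (torus_degree TYPE('d) p \<rho> n) * real (card (pos_verts V \<zeta>))
     - 2 * real (card {e \<in> torus_edges p \<rho> n. e \<subseteq> pos_verts V \<zeta>})"

definition weight ::
    "ereal \<Rightarrow> real \<Rightarrow> nat \<Rightarrow> real \<Rightarrow> real \<Rightarrow> (int ^ 'd::finite) set \<Rightarrow> (int ^ 'd \<Rightarrow> real) \<Rightarrow> real" where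
  "weight p \<rho> n a b V \<zeta> =
     exp (2 * a * real (card (pos_verts V \<zeta>)) - 2 * b * perimeter p \<rho> n V \<zeta>)"

text \<open>The product over an edge \<open>{x, y}\<close> is \<open>\<sigma> x * \<sigma> y\<close>.\<close>

definition boltzmann :: "ereal \<Rightarrow> real \<Rightarrow> nat \<Rightarrow> real \<Rightarrow> real \<Rightarrow> (int ^ 'd::finite \<Rightarrow> real) \<Rightarrow> real" where
  "boltzmann p \<rho> n a b \<sigma> =
     exp (a * (\<Sum>x\<in>torus_verts n. \<sigma> x) + b * (\<Sum>e\<in>torus_edges p \<rho> n. \<Prod>x\<in>e. \<sigma> x))"

definition ising ::
    "ereal \<Rightarrow> real \<Rightarrow> nat \<Rightarrow> real \<Rightarrow> real \<Rightarrow> (int ^ 'd::finite \<Rightarrow> real) measure" where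
  "ising p \<rho> n a b =
     point_measure (configs (torus_verts n))
       (\<lambda>\<sigma>. ennreal (boltzmann p \<rho> n a b \<sigma> /
                       (\<Sum>\<tau>\<in>configs (torus_verts n :: (int ^ 'd) set). boltzmann p \<rho> n a b \<tau>)))"


section \<open>Local configurations\<close>

text \<open>
  For \<open>n > 2 * \<rho> * r\<close> the balls of radius \<open>r\<close> around the origin of the tori are all identified, via
  \<open>wrap n\<close>, with the ball of radius \<open>r\<close> of the infinite lattice graph (see \<open>wrap_bij_betw\<close>
  below), on which local configurations therefore live.
\<close>

definition lattice_edges :: "ereal \<Rightarrow> real \<Rightarrow> (int ^ 'd::finite) set set" where
  "lattice_edges p \<rho> = {{x, y} | x y. x \<noteq> y \<and> lp_norm p (y - x) \<le> \<rho>}"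

definition local_ball :: "ereal \<Rightarrow> real \<Rightarrow> nat \<Rightarrow> (int ^ 'd::finite) set" where
  "local_ball p \<rho> r = graph_ball UNIV (lattice_edges p \<rho>) 0 r"

definition local_configs :: "ereal \<Rightarrow> real \<Rightarrow> nat \<Rightarrow> (int ^ 'd::finite \<Rightarrow> real) set" where
  "local_configs p \<rho> r = configs (local_ball p \<rho> r)"

text \<open>
  The copy of a local configuration on the torus ball around \<open>x\<close>; its defining property is
  \<open>place_apply\<close> below.
\<close>

definition place ::
    "ereal \<Rightarrow> real \<Rightarrow> nat \<Rightarrow> nat \<Rightarrow> (int ^ 'd::finite \<Rightarrow> real) \<Rightarrow> int ^ 'd \<Rightarrow> (int ^ 'd \<Rightarrow> real)" where
  "place p \<rho> r n \<eta> x =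
     (\<lambda>z\<in>torus_ball p \<rho> n x r. \<eta> (inv_into (local_ball p \<rho> r) (\<lambda>y. wrap n (x + y)) z))"

definition local_weight ::
    "ereal \<Rightarrow> real \<Rightarrow> nat \<Rightarrow> nat \<Rightarrow> real \<Rightarrow> real \<Rightarrow> (int ^ 'd::finite \<Rightarrow> real) \<Rightarrow> real" where
  "local_weight p \<rho> r n a b \<eta> = weight p \<rho> n a b (torus_ball p \<rho> n 0 r) (place p \<rho> r n \<eta> 0)"

definition max_or_zero :: "real set \<Rightarrow> real" where
  "max_or_zero A = (if A = {} then 0 else Max A)"

text \<open>By translation invariance the probability gap can be computed at \<open>x = 0\<close>.\<close>

definition prob_gap ::
    "ereal \<Rightarrow> real \<Rightarrow> nat \<Rightarrow> nat \<Rightarrow> real \<Rightarrow> real \<Rightarrow> (int ^ 'd::finite \<Rightarrow> real) \<Rightarrow> real" where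
  "prob_gap p \<rho> r n a b \<eta> =
     (let B = torus_ball p \<rho> n 0 r; D = torus_boundary p \<rho> n B
      in max_or_zero
           ((\<lambda>\<sigma>. weight p \<rho> n a b (B \<union> D) (merge B D (place p \<rho> r n \<eta> 0, \<sigma>))
                   / local_weight p \<rho> r n a b \<eta>)
            ` (configs D - {null_config D})))"

definition larger_configs ::
    "ereal \<Rightarrow> real \<Rightarrow> nat \<Rightarrow> (int ^ 'd::finite \<Rightarrow> real) \<Rightarrow> (int ^ 'd \<Rightarrow> real) set" where
  "larger_configs p \<rho> r \<eta> =
     {\<eta>' \<in> local_configs p \<rho> r.
        pos_verts (local_ball p \<rho> r) \<eta> \<subseteq> pos_verts (local_ball p \<rho> r) \<eta>'}"

definition max_prob ::
    "ereal \<Rightarrow> real \<Rightarrow> nat \<Rightarrow> nat \<Rightarrow> real \<Rightarrow> real \<Rightarrow> (int ^ 'd::finite \<Rightarrow> real) \<Rightarrow> real" where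
  "max_prob p \<rho> r n a b \<eta> =
     max_or_zero
       ((\<lambda>\<eta>'. local_weight p \<rho> r n a b \<eta>' / local_weight p \<rho> r n a b \<eta>)
        ` (larger_configs p \<rho> r \<eta> - {\<eta>}))"


section \<open>Consistency of the encoding\<close>

lemma finite_torus_verts [simp]: "finite (torus_verts n :: (int ^ 'd::finite) set)"
proof -
  have "(torus_verts n :: (int ^ 'd) set) \<subseteq> vec_lambda ` (UNIV \<rightarrow>\<^sub>E {0..<int n})"
  proof
    fix x :: "int ^ 'd" assume "x \<in> torus_verts n"
    then show "x \<in> vec_lambda ` (UNIV \<rightarrow>\<^sub>E {0..<int n})"
      by (intro image_eqI[where x = "vec_nth x"]) (auto simp: torus_verts_def vec_nth_inverse)
  qed
  then show ?thesis by (rule finite_subset) (intro finite_imageI finite_PiE, auto)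
qed

lemma finite_configs: "finite V \<Longrightarrow> finite (configs V)"
  by (auto simp: configs_def intro: finite_PiE)

lemma prob_space_ising: "prob_space (ising p \<rho> n a b :: (int ^ 'd::finite \<Rightarrow> real) measure)"
proof
  let ?C = "configs (torus_verts n) :: (int ^ 'd \<Rightarrow> real) set"
  let ?w = "boltzmann p \<rho> n a b :: (int ^ 'd \<Rightarrow> real) \<Rightarrow> real"
  have fin: "finite ?C" by (simp add: finite_configs)
  have "null_config (torus_verts n) \<in> ?C" by (auto simp: configs_def null_config_def)
  then have pos: "(\<Sum>\<tau>\<in>?C. ?w \<tau>) > 0"
    using fin by (intro sum_pos) (auto simp: boltzmann_def)
  have "emeasure (ising p \<rho> n a b) ?C = (\<Sum>\<sigma>\<in>?C. ennreal (?w \<sigma> / (\<Sum>\<tau>\<in>?C. ?w \<tau>)))"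
    unfolding ising_def using fin by (simp add: emeasure_point_measure_finite)
  also have "\<dots> = ennreal (\<Sum>\<sigma>\<in>?C. ?w \<sigma> / (\<Sum>\<tau>\<in>?C. ?w \<tau>))"
    using pos by (intro sum_ennreal) (auto simp: boltzmann_def intro!: divide_nonneg_pos)
  also have "\<dots> = 1" using pos by (simp flip: sum_divide_distrib)
  finally show "emeasure (ising p \<rho> n a b) (space (ising p \<rho> n a b :: (int ^ 'd \<Rightarrow> real) measure)) = 1"
    by (simp add: ising_def space_point_measure)
qed

lemma abs_le_lp_norm:
  fixes x :: "int ^ 'd::finite"
  assumes "1 \<le> p"
  shows "real_of_int \<bar>x $ i\<bar> \<le> lp_norm p x"
proof (cases "p = \<infinity>")
  case True
  then show ?thesis by (auto simp: lp_norm_def intro!: Max_ge)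
next
  case False
  with assms have q: "real_of_ereal p \<ge> 1" by (cases p) auto
  let ?q = "real_of_ereal p"
  have "real_of_int \<bar>x $ i\<bar> powr ?q \<le> (\<Sum>i\<in>UNIV. real_of_int \<bar>x $ i\<bar> powr ?q)"
    by (rule member_le_sum) auto
  then have "(real_of_int \<bar>x $ i\<bar> powr ?q) powr (1 / ?q)
      \<le> (\<Sum>i\<in>UNIV. real_of_int \<bar>x $ i\<bar> powr ?q) powr (1 / ?q)"
    using q by (intro powr_mono2) auto
  moreover have "(real_of_int \<bar>x $ i\<bar> powr ?q) powr (1 / ?q) = real_of_int \<bar>x $ i\<bar>"
    using q by (simp add: powr_powr)
  ultimately show ?thesis using False by (simp add: lp_norm_def)
qed

lemma lp_norm_minus_commute: "lp_norm p (x - y) = lp_norm p (y - x)"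
  by (simp add: lp_norm_def abs_minus_commute)

lemma lattice_edge_iff:
  "{x, y} \<in> lattice_edges p \<rho> \<longleftrightarrow> x \<noteq> y \<and> lp_norm p (y - x) \<le> \<rho>"
  unfolding lattice_edges_def
  by (auto simp: doubleton_eq_iff lp_norm_minus_commute[of p x y])

lemma wrap_in_torus: "n > 0 \<Longrightarrow> wrap n x \<in> torus_verts n"
  by (simp add: torus_verts_def wrap_def)

lemma wrap_torus: "x \<in> torus_verts n \<Longrightarrow> wrap n x = x"
  by (simp add: torus_verts_def wrap_def vec_eq_iff)

lemma central_rep_small:
  assumes "\<And>i. 2 * \<bar>x $ i\<bar> < int n"
  shows "central_rep n x = x"
proof -
  have "(if 2 * (u mod int n) \<le> int n then u mod int n else u mod int n - int n) = u"
    if "2 * \<bar>u\<bar> < int n" for u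
  proof (cases "u \<ge> 0")
    case True then show ?thesis using that by auto
  next
    case False
    then have "u mod int n = u + int n"
      using that by (subst mod_add_self2[symmetric], intro mod_pos_pos_trivial) auto
    then show ?thesis using that False by auto
  qed
  with assms show ?thesis by (simp add: central_rep_def vec_eq_iff)
qed

lemma central_rep_cong: "wrap n x = wrap n y \<Longrightarrow> central_rep n x = central_rep n y"
  by (simp add: central_rep_def wrap_def vec_eq_iff)

lemma wrap_central_rep: "wrap n (central_rep n x) = wrap n x"
  by (simp add: central_rep_def wrap_def vec_eq_iff)

lemma wrap_add_wrap: "wrap n (x + wrap n y) = wrap n (x + y)"
  by (simp add: wrap_def vec_eq_iff mod_simps)

lemma wrap_diff_wrap: "wrap n (wrap n x - wrap n y) = wrap n (x - y)"
  by (simp add: wrap_def vec_eq_iff mod_simps)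

lemma central_rep_minus_norm:
  "lp_norm p (central_rep n (x - y)) = lp_norm p (central_rep n (y - x))"
proof -
  have "\<bar>central_rep n (x - y) $ i\<bar> = \<bar>central_rep n (y - x) $ i\<bar>" for i
  proof (cases "n = 0")
    case True
    then show ?thesis by (auto simp: central_rep_def)
  next
    case False
    let ?u = "x $ i - y $ i"
    have e: "(y $ i - x $ i) mod int n = (if ?u mod int n = 0 then 0 else int n - ?u mod int n)"
      using zmod_zminus1_eq_if[of ?u "int n"] by simp
    have "0 \<le> ?u mod int n" "?u mod int n < int n" using False by simp_all
    then show ?thesis unfolding central_rep_def by (simp add: e)
  qed
  then show ?thesis by (simp add: lp_norm_def)
qed

lemma torus_edge_iff:
  "{x, y} \<in> torus_edges p \<rho> n \<longleftrightarrow> x \<in> torus_verts n \<and> y \<in> torus_verts n \<and> x \<noteq> y \<and>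
     lp_norm p (central_rep n (y - x)) \<le> \<rho>"
  unfolding torus_edges_def
  by (auto simp: doubleton_eq_iff central_rep_minus_norm[of p n x y])

lemma mem_graph_ball_iff:
  "y \<in> graph_ball X E x r \<longleftrightarrow> y \<in> X \<and> (\<exists>k\<le>r. (x, y) \<in> {(u, v). {u, v} \<in> E} ^^ k)"
proof -
  let ?K = "{k. (x, y) \<in> {(u, v). {u, v} \<in> E} ^^ k}"
  have "(INF k\<in>?K. enat k) \<le> enat r \<longleftrightarrow> (\<exists>k\<in>?K. k \<le> r)"
  proof
    assume le: "(INF k\<in>?K. enat k) \<le> enat r"
    have ne: "?K \<noteq> {}"
    proof
      assume "?K = {}"
      with le show False by (simp only: image_empty Inf_empty top_enat_def) simp
    qed
    then have "\<exists>m. m \<in> enat ` ?K" by blast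
    then have "(LEAST m. m \<in> enat ` ?K) \<in> enat ` ?K" by (rule LeastI_ex)
    then have "(INF k\<in>?K. enat k) \<in> enat ` ?K" using ne by (simp add: Inf_enat_def)
    with le show "\<exists>k\<in>?K. k \<le> r" by auto
  next
    assume "\<exists>k\<in>?K. k \<le> r"
    then show "(INF k\<in>?K. enat k) \<le> enat r" by (meson INF_lower2 enat_ord_simps(1))
  qed
  then show ?thesis by (auto simp: graph_ball_def graph_dist_def)
qed

lemma local_path_bound:
  fixes y :: "int ^ 'd::finite"
  assumes "1 \<le> p" "(0, y) \<in> {(u, v). {u, v} \<in> lattice_edges p \<rho>} ^^ k"
  shows "real_of_int \<bar>y $ i\<bar> \<le> \<rho> * real k"
  using assms(2)
proof (induction k arbitrary: y)
  case 0 then show ?case by simp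
next
  case (Suc k)
  then obtain z where z: "(0, z) \<in> {(u, v). {u, v} \<in> lattice_edges p \<rho>} ^^ k"
    "{z, y} \<in> lattice_edges p \<rho>" by auto
  have "real_of_int \<bar>(y - z) $ i\<bar> \<le> \<rho>"
    using abs_le_lp_norm[OF assms(1), of "y - z" i] z(2) by (simp add: lattice_edge_iff)
  with Suc.IH[OF z(1)] show ?case by (simp add: algebra_simps)
qed

context
  fixes p :: ereal and \<rho> :: real and r n :: nat
  assumes p: "1 \<le> p" and \<rho>: "1 \<le> \<rho>" and n: "real n > 2 * \<rho> * real r" and r: "0 < r"
begin

lemma two_rho_less: "2 * \<rho> < real n"
proof -
  have "2 * \<rho> * 1 \<le> 2 * \<rho> * real r" using \<rho> r by (intro mult_left_mono) auto
  with n show ?thesis by simp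
qed

lemma n_pos: "0 < n" using two_rho_less \<rho> by (cases n) auto

lemma local_ball_bound:
  fixes y :: "int ^ 'd::finite"
  assumes "y \<in> local_ball p \<rho> r"
  shows "2 * \<bar>y $ i\<bar> < int n"
proof -
  from assms obtain k where k: "k \<le> r" "(0, y) \<in> {(u, v). {u, v} \<in> lattice_edges p \<rho>} ^^ k"
    by (auto simp: local_ball_def mem_graph_ball_iff)
  have "real_of_int \<bar>y $ i\<bar> \<le> \<rho> * real k" by (rule local_path_bound[OF p k(2)])
  also have "\<dots> \<le> \<rho> * real r" using k(1) \<rho> by (intro mult_left_mono) auto
  finally show ?thesis using n by linarith
qed

lemma inj_on_wrap_add: "inj_on (\<lambda>y. wrap n (x + y)) (local_ball p \<rho> r :: (int ^ 'd::finite) set)"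
proof (rule inj_onI)
  fix y z :: "int ^ 'd"
  assume *: "y \<in> local_ball p \<rho> r" "z \<in> local_ball p \<rho> r" "wrap n (x + y) = wrap n (x + z)"
  then have "wrap n (y + - x + x) = wrap n (z + - x + x)"
    by (simp add: wrap_def vec_eq_iff) (metis add_diff_cancel_left' mod_diff_left_eq)
  then have "central_rep n y = central_rep n z" by (intro central_rep_cong) simp
  moreover have "central_rep n y = y" by (rule central_rep_small) (rule local_ball_bound[OF *(1)])
  moreover have "central_rep n z = z" by (rule central_rep_small) (rule local_ball_bound[OF *(2)])
  ultimately show "y = z" by simp
qed

lemma torus_edge_wrap:
  fixes x y :: "int ^ 'd::finite"
  assumes "{x, y} \<in> lattice_edges p \<rho>"
  shows "{wrap n x, wrap n y} \<in> torus_edges p \<rho> n"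
proof -
  from assms have xy: "x \<noteq> y" "lp_norm p (y - x) \<le> \<rho>" by (auto simp: lattice_edge_iff)
  have "2 * \<bar>(y - x) $ i\<bar> < int n" for i
    using abs_le_lp_norm[OF p, of "y - x" i] xy(2) two_rho_less by linarith
  then have *: "central_rep n (y - x) = y - x" by (rule central_rep_small)
  have c: "central_rep n (wrap n y - wrap n x) = central_rep n (y - x)"
    by (intro central_rep_cong wrap_diff_wrap)
  have "wrap n x \<noteq> wrap n y"
  proof
    assume "wrap n x = wrap n y"
    then have "central_rep n (0 :: int ^ 'd) = y - x" using c * by simp
    moreover have "central_rep n (0 :: int ^ 'd) = 0" using n_pos by (intro central_rep_small) simp
    ultimately show False using xy(1) by simp
  qed
  with c * xy show ?thesis by (simp add: torus_edge_iff wrap_in_torus n_pos)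
qed

lemma lattice_edge_lift:
  fixes x w :: "int ^ 'd::finite"
  assumes "{wrap n x, w} \<in> torus_edges p \<rho> n"
  shows "\<exists>y. w = wrap n y \<and> {x, y} \<in> lattice_edges p \<rho>"
proof (intro exI conjI)
  let ?y = "x + central_rep n (w - wrap n x)"
  have w: "w \<in> torus_verts n" "wrap n x \<noteq> w" "lp_norm p (central_rep n (w - wrap n x)) \<le> \<rho>"
    using assms by (auto simp: torus_edge_iff)
  have "wrap n ?y = wrap n (x + wrap n (w - wrap n x))"
    by (metis wrap_add_wrap wrap_central_rep)
  also have "\<dots> = wrap n w" by (simp add: wrap_def vec_eq_iff mod_simps)
  finally show y: "w = wrap n ?y" using w(1) by (simp add: wrap_torus)
  then have "x \<noteq> ?y" using w(2) by metis
  then show "{x, ?y} \<in> lattice_edges p \<rho>" using w(3) by (simp add: lattice_edge_iff)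
qed

lemma torus_edge_translate:
  fixes x :: "int ^ 'd::finite"
  assumes "{u, v} \<in> torus_edges p \<rho> n"
  shows "{wrap n (x + u), wrap n (x + v)} \<in> torus_edges p \<rho> n"
proof -
  have uv: "u \<in> torus_verts n" "v \<in> torus_verts n" "u \<noteq> v" "lp_norm p (central_rep n (v - u)) \<le> \<rho>"
    using assms by (auto simp: torus_edge_iff)
  have "wrap n (wrap n (x + v) - wrap n (x + u)) = wrap n (v - u)"
    using wrap_diff_wrap[of n "x + v" "x + u"] by simp
  then have c: "central_rep n (wrap n (x + v) - wrap n (x + u)) = central_rep n (v - u)"
    by (rule central_rep_cong)
  have "wrap n (x + u) \<noteq> wrap n (x + v)"
  proof
    assume "wrap n (x + u) = wrap n (x + v)"
    then have "wrap n (- x + wrap n (x + u)) = wrap n (- x + wrap n (x + v))" by simp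
    then have "wrap n u = wrap n v" unfolding wrap_add_wrap by simp
    then show False using uv by (simp add: wrap_torus)
  qed
  with c uv show ?thesis by (simp add: torus_edge_iff wrap_in_torus n_pos)
qed

lemma torus_ball_eq:
  fixes x :: "int ^ 'd::finite"
  assumes x: "x \<in> torus_verts n"
  shows "torus_ball p \<rho> n x r = (\<lambda>y. wrap n (x + y)) ` local_ball p \<rho> r"
proof -
  let ?R = "{(u, v). {u, v} \<in> torus_edges p \<rho> n}" and ?L = "{(u, v). {u, v} \<in> lattice_edges p \<rho>}"
  have A: "\<exists>y. z = wrap n (x + y) \<and> (0, y) \<in> ?L ^^ k" if "(x, z) \<in> ?R ^^ k" for k z
    using that
  proof (induction k arbitrary: z)
    case 0 then show ?case using x by (auto simp: wrap_torus)
  next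
    case (Suc k)
    then obtain u where u: "(x, u) \<in> ?R ^^ k" "{u, z} \<in> torus_edges p \<rho> n" by auto
    from Suc.IH[OF u(1)] obtain y where y: "u = wrap n (x + y)" "(0, y) \<in> ?L ^^ k" by auto
    from u(2) y(1) obtain t where t: "z = wrap n t" "{x + y, t} \<in> lattice_edges p \<rho>"
      using lattice_edge_lift by metis
    have "{y, t - x} \<in> lattice_edges p \<rho>" using t(2) by (auto simp: lattice_edge_iff algebra_simps)
    with y(2) have "(0, t - x) \<in> ?L ^^ Suc k" by auto
    with t(1) show ?case by (intro exI[of _ "t - x"]) simp
  qed
  have B: "(x, wrap n (x + y)) \<in> ?R ^^ k" if "(0, y) \<in> ?L ^^ k" for k y
    using that
  proof (induction k arbitrary: y)
    case 0 then show ?case using x by (simp add: wrap_torus)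
  next
    case (Suc k)
    then obtain u where u: "(0, u) \<in> ?L ^^ k" "{u, y} \<in> lattice_edges p \<rho>" by auto
    have "{x + u, x + y} \<in> lattice_edges p \<rho>" using u(2) by (simp add: lattice_edge_iff)
    with Suc.IH[OF u(1)] torus_edge_wrap show ?case by auto
  qed
  show ?thesis
    using A B by (fastforce simp: torus_ball_def local_ball_def mem_graph_ball_iff wrap_in_torus n_pos)
qed

lemma wrap_bij_betw:
  "bij_betw (wrap n) (local_ball p \<rho> r) (torus_ball p \<rho> n (0 :: int ^ 'd::finite) r)"
proof -
  have "(0 :: int ^ 'd) \<in> torus_verts n" using n_pos by (simp add: torus_verts_def)
  then show ?thesis
    using inj_on_wrap_add[of "0 :: int ^ 'd"] torus_ball_eq[of "0 :: int ^ 'd"]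
    by (simp add: bij_betw_def)
qed

lemma place_apply:
  fixes x y :: "int ^ 'd::finite"
  assumes "x \<in> torus_verts n" "y \<in> local_ball p \<rho> r"
  shows "wrap n (x + y) \<in> torus_ball p \<rho> n x r"
    and "place p \<rho> r n \<eta> x (wrap n (x + y)) = \<eta> y"
  using assms torus_ball_eq[OF assms(1)] inv_into_f_f[OF inj_on_wrap_add assms(2), of x]
  by (auto simp: place_def)

lemma torus_degree_eq:
  fixes x :: "int ^ 'd::finite"
  assumes "x \<in> torus_verts n"
  shows "card {y \<in> torus_verts n. {x, y} \<in> torus_edges p \<rho> n} = torus_degree TYPE('d) p \<rho> n"
proof -
  have "bij_betw (\<lambda>y. wrap n (x + y))
     {y. y \<in> torus_verts n \<and> {0, y} \<in> torus_edges p \<rho> n}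
     {y \<in> torus_verts n. {x, y} \<in> torus_edges p \<rho> n}"
  proof (rule bij_betwI[where g = "\<lambda>y. wrap n (- x + y)"])
    show "wrap n (- x + wrap n (x + y)) = y" if "y \<in> {y. y \<in> torus_verts n \<and> {0, y} \<in> torus_edges p \<rho> n}" for y
      unfolding wrap_add_wrap using that by (simp add: wrap_torus)
    show "wrap n (x + wrap n (- x + y)) = y" if "y \<in> {y \<in> torus_verts n. {x, y} \<in> torus_edges p \<rho> n}" for y
      unfolding wrap_add_wrap using that by (simp add: wrap_torus)
    show "(\<lambda>y. wrap n (x + y)) \<in> {y. y \<in> torus_verts n \<and> {0, y} \<in> torus_edges p \<rho> n}
        \<rightarrow> {y \<in> torus_verts n. {x, y} \<in> torus_edges p \<rho> n}"
      using torus_edge_translate[of 0 _ x] assms by (auto simp: wrap_torus wrap_in_torus n_pos)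
    show "(\<lambda>y. wrap n (- x + y)) \<in> {y \<in> torus_verts n. {x, y} \<in> torus_edges p \<rho> n}
        \<rightarrow> {y. y \<in> torus_verts n \<and> {0, y} \<in> torus_edges p \<rho> n}"
      using torus_edge_translate[of x _ "- x"] by (auto simp: wrap_in_torus n_pos) (simp add: wrap_def zero_vec_def)
  qed
  then show ?thesis unfolding torus_degree_def by (rule bij_betw_same_card[symmetric])
qed

end

end

theory Submission
  imports Defs
begin

text \<open>
  Up to a constant factor, the Boltzmann weight of a configuration is \<open>W S\<close>, where \<open>S\<close> is its set of
  positive vertices.  Writing \<open>D\<close> for the degree, adding a set \<open>L\<close> of positive vertices multiplies
  \<open>W\<close> by at most \<open>x ^ card L\<close> with \<open>x = exp (2 * (a + D * b))\<close>.  Part (2) follows at once, since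
  \<open>x\<close> tends to 0.

  For part (1) let \<open>A\<close> be the set of positive vertices of \<open>\<zeta>\<close>, and split the positive vertices
  outside \<open>V\<close> into those adjacent to \<open>A\<close>, say \<open>L\<close>, and the others.  The latter do not interact
  with \<open>A\<close>, so that induction, applied to \<open>L\<close> in place of \<open>A\<close>, bounds the contribution of \<open>L\<close> by
  \<open>(2 * x) ^ card L\<close>.  Summing over \<open>L\<close> gives at most \<open>(1 + 2 * x) ^ (D * card A)\<close>, which is at most
  \<open>2 ^ card A\<close> once \<open>x\<close> is small.  The latter holds for large \<open>n\<close>: \<open>a + 2 * D * b \<le> 0\<close> gives
  \<open>x \<le> exp a\<close> and \<open>exp (3 * a * k) \<le> W\<close> for a local configuration with \<open>k\<close> positive vertices, whence
  \<open>a\<close> tends to \<open>-\<infinity>\<close> because \<open>n ^ d * W\<close> is constant; and \<open>D\<close> is bounded.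
\<close>

section \<open>Sums over power sets\<close>

lemma sum_Pow_split:
  fixes f :: "'a set \<Rightarrow> 'b::comm_monoid_add"
  assumes "N \<subseteq> U"
  shows "(\<Sum>S\<in>Pow U. f S) = (\<Sum>L\<in>Pow N. \<Sum>S\<in>Pow (U - N). f (L \<union> S))"
proof -
  have "(\<Sum>S\<in>Pow U. f S) = (\<Sum>(L, S)\<in>Pow N \<times> Pow (U - N). f (L \<union> S))"
  proof (rule sum.reindex_bij_witness[where i = "\<lambda>(L, S). L \<union> S" and j = "\<lambda>S. (S \<inter> N, S - N)"])
    fix S show "(case (S \<inter> N, S - N) of (L, S) \<Rightarrow> f (L \<union> S)) = f S"
      by (simp add: Int_Diff_Un)
  qed (use assms in auto)
  then show ?thesis by (simp add: sum.cartesian_product)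
qed

text \<open>Expanding the product of the factors \<open>1 + y\<close> over \<open>N\<close> gives
  one term \<open>y ^ card L\<close> for each choice \<open>L\<close> of the factors that contribute
  \<open>y\<close>.\<close>

lemma sum_Pow_power_card:
  fixes y :: "'b::comm_semiring_1"
  assumes "finite N"
  shows "(\<Sum>L\<in>Pow N. y ^ card L) = (1 + y) ^ card N"
  using prod_add[OF assms, of "\<lambda>_. y" "\<lambda>_. 1"] by (simp add: add.commute)

section \<open>Weights of vertex sets in a finite regular graph\<close>

locale regular_finite_graph =
  fixes X :: "'a set" and E :: "'a set set" and D :: nat
  assumes finite_X: "finite X"
    and edgeE: "e \<in> E \<Longrightarrow> \<exists>x\<in>X. \<exists>y\<in>X. x \<noteq> y \<and> e = {x, y}"
    and card_neighbours: "x \<in> X \<Longrightarrow> card {y \<in> X. {x, y} \<in> E} = D"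
begin

definition edges_in :: "'a set \<Rightarrow> nat" where
  "edges_in S = card {e \<in> E. e \<subseteq> S}"

text \<open>This is the weight \<open>W_n\<close> as a function of the positive vertices alone; the
  bracket after \<open>2 * b\<close> is the perimeter.\<close>

definition set_weight :: "real \<Rightarrow> real \<Rightarrow> 'a set \<Rightarrow> real" where
  "set_weight a b S =
     exp (2 * a * real (card S) - 2 * b * (real D * real (card S) - 2 * real (edges_in S)))"

lemma set_weight_pos: "set_weight a b S > 0"
  by (simp add: set_weight_def)

lemma finite_E: "finite E"
proof (rule finite_subset)
  show "E \<subseteq> Pow X" using edgeE by blast
qed (simp add: finite_X)

lemma card_incident:
  assumes "x \<in> X" shows "card {e \<in> E. x \<in> e} = D"
proof -
  have "bij_betw (\<lambda>y. {x, y}) {y \<in> X. {x, y} \<in> E} {e \<in> E. x \<in> e}"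
    unfolding bij_betw_def
  proof
    show "inj_on (\<lambda>y. {x, y}) {y \<in> X. {x, y} \<in> E}"
      by (auto simp: inj_on_def doubleton_eq_iff)
    show "(\<lambda>y. {x, y}) ` {y \<in> X. {x, y} \<in> E} = {e \<in> E. x \<in> e}"
    proof (intro equalityI subsetI)
      fix e assume "e \<in> {e \<in> E. x \<in> e}"
      then obtain y where "e = {x, y}" "y \<in> X" "e \<in> E"
        using edgeE[of e] by (metis (no_types, lifting) insert_commute insert_iff mem_Collect_eq singletonD)
      then show "e \<in> (\<lambda>y. {x, y}) ` {y \<in> X. {x, y} \<in> E}" by auto
    qed auto
  qed
  then show ?thesis using card_neighbours[OF assms] by (simp add: bij_betw_same_card[symmetric])
qed

text \<open>An edge inside \<open>insert x S\<close> either lies in \<open>S\<close> or contains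
  \<open>x\<close>, and only \<open>D\<close> edges contain \<open>x\<close>.\<close>

lemma edges_in_insert_le:
  assumes "x \<in> X" shows "edges_in (insert x S) \<le> edges_in S + D"
proof -
  have "edges_in (insert x S) \<le> card ({e \<in> E. e \<subseteq> S} \<union> {e \<in> E. x \<in> e})"
    unfolding edges_in_def by (rule card_mono) (auto simp: finite_E)
  also have "\<dots> \<le> edges_in S + D"
    using card_Un_le[of "{e \<in> E. e \<subseteq> S}" "{e \<in> E. x \<in> e}"]
    by (simp add: edges_in_def card_incident[OF assms])
  finally show ?thesis .
qed

lemma edges_in_Un_le:
  assumes "L \<subseteq> X" shows "edges_in (A \<union> L) \<le> edges_in A + D * card L"
proof -
  have "finite L" using assms finite_X finite_subset by blast
  then show ?thesis using assms
  proof (induction L)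
    case (insert x L)
    then show ?case using edges_in_insert_le[of x "A \<union> L"] by simp
  qed simp
qed

text \<open>Each vertex of \<open>L\<close> creates at most \<open>D\<close> new inner edges, so it
  changes the perimeter by at least \<open>D - 2 * D = - D\<close>. As \<open>b \<ge> 0\<close>, the
  exponent grows by at most \<open>2 * a + 2 * D * b\<close> per vertex.\<close>

lemma set_weight_Un_le:
  assumes "A \<subseteq> X" "L \<subseteq> X" "A \<inter> L = {}" "b \<ge> 0"
  shows "set_weight a b (A \<union> L) \<le> set_weight a b A * exp (2 * (a + real D * b)) ^ card L"
proof -
  have fin: "finite A" "finite L" using assms finite_X finite_subset by blast+
  have "real (edges_in (A \<union> L)) \<le> real (edges_in A) + real D * real (card L)"
    using edges_in_Un_le[OF assms(2), of A] by (simp flip: of_nat_mult of_nat_add)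
  then have "b * real (edges_in (A \<union> L)) \<le> b * (real (edges_in A) + real D * real (card L))"
    using assms(4) by (rule mult_left_mono)
  then show ?thesis
    by (simp add: set_weight_def card_Un_disjoint fin assms(3) algebra_simps
        flip: exp_of_nat_mult exp_add)
qed

text \<open>This is the Markov property: \<open>L\<close> separates \<open>A\<close> from
  \<open>S\<close>. Every edge inside the union lies in \<open>A \<union> L\<close> or in
  \<open>L \<union> S\<close>, and the edges lying in both are those inside \<open>L\<close>, so
  inclusion-exclusion for edges and vertices makes the exponents agree.\<close>

lemma set_weight_factor:
  assumes "A \<inter> L = {}" "A \<inter> S = {}" "L \<inter> S = {}" "A \<subseteq> X" "L \<subseteq> X" "S \<subseteq> X"
    and no_edge: "\<And>x y. x \<in> A \<Longrightarrow> y \<in> S \<Longrightarrow> {x, y} \<notin> E"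
  shows "set_weight a b (A \<union> L \<union> S) * set_weight a b L = set_weight a b (A \<union> L) * set_weight a b (L \<union> S)"
proof -
  have fin: "finite A" "finite L" "finite S" using assms finite_X finite_subset by blast+
  let ?F = "\<lambda>T. {e \<in> E. e \<subseteq> T}"
  have "?F (A \<union> L \<union> S) \<subseteq> ?F (A \<union> L) \<union> ?F (L \<union> S)"
  proof
    fix e assume e: "e \<in> ?F (A \<union> L \<union> S)"
    then obtain x y where "e = {x, y}" using edgeE by blast
    moreover from this have "e = {y, x}" by blast
    ultimately show "e \<in> ?F (A \<union> L) \<union> ?F (L \<union> S)" using e no_edge[of x y] no_edge[of y x] by auto
  qed
  then have "?F (A \<union> L \<union> S) = ?F (A \<union> L) \<union> ?F (L \<union> S)" by auto
  moreover have "?F L = ?F (A \<union> L) \<inter> ?F (L \<union> S)" using assms(2) by auto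
  ultimately have "edges_in (A \<union> L \<union> S) + edges_in L = edges_in (A \<union> L) + edges_in (L \<union> S)"
    unfolding edges_in_def using card_Un_Int[of "?F (A \<union> L)" "?F (L \<union> S)"] finite_E by simp
  then have e: "real (edges_in (A \<union> L \<union> S)) = real (edges_in (A \<union> L)) + real (edges_in (L \<union> S)) - real (edges_in L)"
    by (simp flip: of_nat_add)
  have "card (A \<union> L \<union> S) = card A + card L + card S" "card (A \<union> L) = card A + card L"
    "card (L \<union> S) = card L + card S"
    using assms fin by (simp_all add: card_Un_disjoint Int_Un_distrib2)
  then show ?thesis by (simp add: set_weight_def e algebra_simps flip: exp_add)
qed

lemma card_outer_boundary_le:
  assumes "A \<subseteq> X" shows "card (outer_boundary X E A) \<le> D * card A"
proof -
  have fin: "finite A" using assms finite_X finite_subset by blast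
  have "card (outer_boundary X E A) \<le> card (\<Union>x\<in>A. {y \<in> X. {x, y} \<in> E})"
    using fin finite_X by (intro card_mono) (auto simp: outer_boundary_def)
  also have "\<dots> \<le> (\<Sum>x\<in>A. card {y \<in> X. {x, y} \<in> E})" by (rule card_UN_le[OF fin])
  also have "\<dots> = D * card A" using assms by (simp add: card_neighbours subset_iff)
  finally show ?thesis .
qed

text \<open>The key estimate: interaction with the outside costs at most a factor 2 per vertex of
  \<open>A\<close>. The induction is on the size of \<open>U\<close> with \<open>A\<close>
  arbitrary, since the same estimate is needed for the positive neighbours \<open>L\<close> of
  \<open>A\<close> against the part of \<open>U\<close> not adjacent to \<open>A\<close>.\<close>

lemma sum_set_weight_Un_le:
  assumes "b \<ge> 0" "(1 + 2 * exp (2 * (a + real D * b))) ^ D \<le> 2"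
    and "A \<subseteq> X" "U \<subseteq> X" "A \<inter> U = {}"
  shows "(\<Sum>S\<in>Pow U. set_weight a b (A \<union> S)) \<le> 2 ^ card A * set_weight a b A * (\<Sum>S\<in>Pow U. set_weight a b S)"
  using assms(3-5)
proof (induction "card U" arbitrary: A U rule: less_induct)
  case less
  let ?w = "set_weight a b" and ?x = "exp (2 * (a + real D * b))"
  let ?N = "outer_boundary X E A \<inter> U"
  let ?U = "U - ?N"
  have fin: "finite A" "finite U" using less.prems finite_X finite_subset by blast+
  have no_edge: "{x, y} \<notin> E" if "x \<in> A" "y \<in> ?U" for x y
    using that less.prems by (auto simp: outer_boundary_def)
  have w0: "?w S \<ge> 0" for S by (rule less_imp_le[OF set_weight_pos])
  \<comment> \<open>This fixes the set \<open>L\<close> of positive neighbours. Adding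
    \<open>L\<close> to \<open>A\<close> gives the factor \<open>?x ^ card L\<close>, and the
    interaction of \<open>L\<close> with \<open>?U\<close> gives \<open>2 ^ card L\<close>.\<close>
  have layer: "(\<Sum>S\<in>Pow ?U. ?w (A \<union> (L \<union> S))) \<le> ?w A * (2 * ?x) ^ card L * (\<Sum>S\<in>Pow ?U. ?w S)"
    if L: "L \<subseteq> ?N" for L
  proof -
    have IH: "(\<Sum>S\<in>Pow ?U. ?w (L \<union> S)) \<le> 2 ^ card L * ?w L * (\<Sum>S\<in>Pow ?U. ?w S)"
    proof (cases "L = {}")
      \<comment> \<open>Here \<open>?U\<close> may equal \<open>U\<close>, so the induction
        hypothesis need not apply; but the empty set has weight 1 and both sides coincide.\<close>
      case True
      have "{e \<in> E. e \<subseteq> {}} = {}" using edgeE by blast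
      then have "?w {} = 1" by (simp add: set_weight_def edges_in_def)
      with True show ?thesis by simp
    next
      case False
      with L have "?U \<subset> U" by auto
      then have "card ?U < card U" by (rule psubset_card_mono[OF fin(2)])
      then show ?thesis using less.prems L by (intro less.hyps) auto
    qed
    \<comment> \<open>Given \<open>L\<close>, the sum over \<open>?U\<close> no longer depends on
      \<open>A\<close>: the Markov property takes the ratio of weights out of the sum.\<close>
    have "(\<Sum>S\<in>Pow ?U. ?w (A \<union> (L \<union> S))) = ?w (A \<union> L) / ?w L * (\<Sum>S\<in>Pow ?U. ?w (L \<union> S))"
      unfolding sum_distrib_left
    proof (rule sum.cong[OF refl])
      fix S assume S: "S \<in> Pow ?U"
      have "?w (A \<union> L \<union> S) * ?w L = ?w (A \<union> L) * ?w (L \<union> S)"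
      proof (rule set_weight_factor)
        show "{x, y} \<notin> E" if "x \<in> A" "y \<in> S" for x y
          using that S no_edge[of x y] by blast
      qed (use S L less.prems in auto)
      then show "?w (A \<union> (L \<union> S)) = ?w (A \<union> L) / ?w L * ?w (L \<union> S)"
        using set_weight_pos[of a b L] by (simp add: field_simps Un_assoc)
    qed
    also have "\<dots> \<le> ?w (A \<union> L) / ?w L * (2 ^ card L * ?w L * (\<Sum>S\<in>Pow ?U. ?w S))"
      by (intro mult_left_mono IH divide_nonneg_nonneg w0)
    also have "\<dots> = ?w (A \<union> L) * (2 ^ card L * (\<Sum>S\<in>Pow ?U. ?w S))"
      using set_weight_pos[of a b L] by simp
    also have "\<dots> \<le> (?w A * ?x ^ card L) * (2 ^ card L * (\<Sum>S\<in>Pow ?U. ?w S))"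
      using L less.prems assms(1)
      by (intro mult_right_mono set_weight_Un_le mult_nonneg_nonneg sum_nonneg w0) auto
    finally show ?thesis by (simp add: power_mult_distrib mult_ac)
  qed
  have "(\<Sum>S\<in>Pow U. ?w (A \<union> S)) = (\<Sum>L\<in>Pow ?N. \<Sum>S\<in>Pow ?U. ?w (A \<union> (L \<union> S)))"
    by (rule sum_Pow_split) simp
  also have "\<dots> \<le> (\<Sum>L\<in>Pow ?N. ?w A * (2 * ?x) ^ card L * (\<Sum>S\<in>Pow ?U. ?w S))"
    by (intro sum_mono layer) auto
  also have "\<dots> = ?w A * (1 + 2 * ?x) ^ card ?N * (\<Sum>S\<in>Pow ?U. ?w S)"
    unfolding sum_distrib_right[symmetric] sum_distrib_left[symmetric]
    using fin by (subst sum_Pow_power_card) simp_all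
  also have "\<dots> \<le> ?w A * 2 ^ card A * (\<Sum>S\<in>Pow U. ?w S)"
  proof (intro mult_mono mult_left_mono)
    \<comment> \<open>There are at most \<open>D\<close> neighbours per vertex of \<open>A\<close>,
      so the smallness hypothesis applies once for each vertex of \<open>A\<close>.\<close>
    have "card ?N \<le> card (outer_boundary X E A)"
      using finite_X by (intro card_mono) (auto simp: outer_boundary_def)
    also have "\<dots> \<le> D * card A" by (rule card_outer_boundary_le[OF less.prems(1)])
    finally have "(1 + 2 * ?x) ^ card ?N \<le> (1 + 2 * ?x) ^ (D * card A)"
      by (intro power_increasing) auto
    also have "\<dots> = ((1 + 2 * ?x) ^ D) ^ card A" by (rule power_mult)
    also have "\<dots> \<le> 2 ^ card A" by (intro power_mono assms(2)) auto
    finally show "(1 + 2 * ?x) ^ card ?N \<le> 2 ^ card A" .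
    show "(\<Sum>S\<in>Pow ?U. ?w S) \<le> (\<Sum>S\<in>Pow U. ?w S)"
      using fin w0 by (intro sum_mono2) auto
  qed (auto intro!: mult_nonneg_nonneg sum_nonneg w0)
  finally show ?case by (simp add: mult_ac)
qed

text \<open>Write each spin as twice an indicator minus 1. The product over an edge is then 1, minus
  twice the number of its positive ends, plus 4 if both ends are positive. Counting positive ends by
  vertices instead of edges gives \<open>D\<close> for each positive vertex.\<close>

lemma sum_edges_prod:
  assumes "\<sigma> \<in> configs X"
  shows "(\<Sum>e\<in>E. \<Prod>x\<in>e. \<sigma> x) =
    real (card E) - 2 * (real D * real (card (pos_verts X \<sigma>)) - 2 * real (edges_in (pos_verts X \<sigma>)))"
proof -
  let ?P = "pos_verts X \<sigma>"
  have \<sigma>: "\<sigma> x = 2 * of_bool (x \<in> ?P) - 1" if "x \<in> X" for x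
    using assms that by (auto simp: configs_def pos_verts_def)
  have "(\<Sum>e\<in>E. \<Prod>x\<in>e. \<sigma> x)
      = (\<Sum>e\<in>E. 1 - 2 * (\<Sum>x\<in>X. of_bool (x \<in> ?P \<and> x \<in> e)) + 4 * of_bool (e \<subseteq> ?P))"
  proof (rule sum.cong[OF refl])
    fix e assume "e \<in> E"
    then obtain x y where xy: "x \<in> X" "y \<in> X" "x \<noteq> y" "e = {x, y}" using edgeE by blast
    have "(\<Sum>v\<in>X. of_bool (v \<in> ?P \<and> v \<in> e)) = (\<Sum>v\<in>{x, y}. of_bool (v \<in> ?P) :: real)"
      using xy finite_X by (intro sum.mono_neutral_cong_right) auto
    then show "(\<Prod>x\<in>e. \<sigma> x) = 1 - 2 * (\<Sum>x\<in>X. of_bool (x \<in> ?P \<and> x \<in> e)) + 4 * of_bool (e \<subseteq> ?P)"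
      using xy by (simp add: \<sigma>)
  qed
  also have "\<dots> = real (card E) - 2 * (\<Sum>e\<in>E. \<Sum>x\<in>X. of_bool (x \<in> ?P \<and> x \<in> e)) + 4 * (\<Sum>e\<in>E. of_bool (e \<subseteq> ?P))"
    by (simp add: sum.distrib sum_subtractf sum_distrib_left)
  also have "(\<Sum>e\<in>E. \<Sum>x\<in>X. of_bool (x \<in> ?P \<and> x \<in> e)) = (\<Sum>x\<in>X. \<Sum>e\<in>E. of_bool (x \<in> ?P \<and> x \<in> e) :: real)"
    by (rule sum.swap)
  also have "\<dots> = (\<Sum>x\<in>?P. real D)"
  proof (rule sum.mono_neutral_cong_right)
    fix x assume "x \<in> ?P"
    then have "(\<Sum>e\<in>E. of_bool (x \<in> ?P \<and> x \<in> e)) = (\<Sum>e\<in>E. of_bool (x \<in> e) :: real)" by simp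
    also have "\<dots> = real D"
      using card_incident[of x] \<open>x \<in> ?P\<close> finite_E by (simp add: pos_verts_def Collect_conj_eq)
    finally show "(\<Sum>e\<in>E. of_bool (x \<in> ?P \<and> x \<in> e)) = real D" .
  qed (auto simp: finite_X pos_verts_def)
  also have "(\<Sum>e\<in>E. of_bool (e \<subseteq> ?P)) = real (edges_in ?P)"
    using finite_E by (simp add: edges_in_def Collect_conj_eq)
  finally show ?thesis by (simp add: algebra_simps)
qed

lemma sum_config:
  assumes "\<sigma> \<in> configs X"
  shows "(\<Sum>x\<in>X. \<sigma> x) = 2 * real (card (pos_verts X \<sigma>)) - real (card X)"
proof -
  have "(\<Sum>x\<in>X. \<sigma> x) = (\<Sum>x\<in>X. 2 * of_bool (x \<in> pos_verts X \<sigma>) - 1)"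
    using assms by (intro sum.cong) (auto simp: configs_def pos_verts_def)
  also have "\<dots> = 2 * real (card (pos_verts X \<sigma>)) - real (card X)"
    using finite_X
    by (simp add: sum_subtractf Int_absorb1 pos_verts_def Collect_conj_eq flip: sum_distrib_left)
  finally show ?thesis .
qed

end

section \<open>From configurations to sets of positive vertices\<close>

lemma sum_configs_restrict:
  fixes f :: "'a set \<Rightarrow> real"
  assumes "V \<subseteq> X" "\<zeta> \<in> configs V"
  shows "(\<Sum>\<sigma>\<in>{\<sigma> \<in> configs X. restrict \<sigma> V = \<zeta>}. f (pos_verts X \<sigma>))
    = (\<Sum>S\<in>Pow (X - V). f (pos_verts V \<zeta> \<union> S))"
\<comment> \<open>An extension of \<open>\<zeta>\<close> to \<open>X\<close> is determined by its
  positive vertices outside \<open>V\<close>, which can be chosen freely.\<close>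
proof (rule sum.reindex_bij_witness[where j = "\<lambda>\<sigma>. pos_verts X \<sigma> - V"
      and i = "\<lambda>S. \<lambda>x\<in>X. if x \<in> V then \<zeta> x else if x \<in> S then 1 else -1"])
  fix \<sigma> assume \<sigma>: "\<sigma> \<in> {\<sigma> \<in> configs X. restrict \<sigma> V = \<zeta>}"
  then have \<zeta>: "\<zeta> = restrict \<sigma> V" by simp
  show "(\<lambda>x\<in>X. if x \<in> V then \<zeta> x else if x \<in> pos_verts X \<sigma> - V then 1 else -1) = \<sigma>"
    using \<sigma> by (auto simp: \<zeta> configs_def pos_verts_def fun_eq_iff PiE_iff extensional_def)
  show "pos_verts X \<sigma> - V \<in> Pow (X - V)" by (auto simp: pos_verts_def)
  have "pos_verts V \<zeta> \<union> (pos_verts X \<sigma> - V) = pos_verts X \<sigma>"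
    using assms(1) by (auto simp: \<zeta> pos_verts_def)
  then show "f (pos_verts V \<zeta> \<union> (pos_verts X \<sigma> - V)) = f (pos_verts X \<sigma>)" by simp
next
  fix S assume S: "S \<in> Pow (X - V)"
  let ?\<sigma> = "\<lambda>x\<in>X. if x \<in> V then \<zeta> x else if x \<in> S then 1 else -1"
  show "pos_verts X ?\<sigma> - V = S" using S by (auto simp: pos_verts_def)
  show "?\<sigma> \<in> {\<sigma> \<in> configs X. restrict \<sigma> V = \<zeta>}"
    using assms by (auto simp: configs_def PiE_iff extensional_def fun_eq_iff restrict_def)
qed

lemma sum_configs_eq_sum_Pow:
  fixes f :: "'a set \<Rightarrow> real"
  shows "(\<Sum>\<sigma>\<in>configs X. f (pos_verts X \<sigma>)) = (\<Sum>S\<in>Pow X. f S)"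
proof -
  \<comment> \<open>By extensionality this is the only configuration on the empty set, so
    restricting to it imposes no condition.\<close>
  have "(\<lambda>_. undefined) \<in> configs {}" by (simp add: configs_def)
  from sum_configs_restrict[OF empty_subsetI this, where X = X and f = f] show ?thesis
    by (simp add: restrict_def pos_verts_def)
qed

lemma pos_verts_merge:
  "B \<inter> D = {} \<Longrightarrow> pos_verts (B \<union> D) (merge B D (f, g)) = pos_verts B f \<union> pos_verts D g"
  by (auto simp: pos_verts_def merge_def)

lemma pos_verts_inj:
  assumes "f \<in> configs V" "g \<in> configs V" "pos_verts V f = pos_verts V g"
  shows "f = g"
proof (rule PiE_ext)
  fix x assume "x \<in> V"
  then have "f x \<in> {-1, 1}" "g x \<in> {-1, 1}" "f x = 1 \<longleftrightarrow> g x = 1"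
    using assms by (auto simp: configs_def pos_verts_def)
  then show "f x = g x" by auto
qed (use assms in \<open>auto simp: configs_def\<close>)

text \<open>The assumption \<open>0 \<le> c\<close> covers the empty set, where the value is 0 by
  convention.\<close>

lemma max_or_zero_bounds:
  assumes "finite A" "\<And>x. x \<in> A \<Longrightarrow> 0 \<le> x \<and> x \<le> c" "0 \<le> c"
  shows "0 \<le> max_or_zero A \<and> max_or_zero A \<le> c"
  using assms Max_in[OF assms(1)] by (auto simp: max_or_zero_def)

section \<open>The Ising measure on the torus\<close>

text \<open>The parameter \<open>dimension\<close> only serves to fix the type variable \<open>'d\<close>.\<close>

locale ising_torus =
  fixes dimension :: "'d::finite itself" and p :: ereal and \<rho> :: real and r n :: nat
  assumes p: "1 \<le> p" and rho: "1 \<le> \<rho>" and n: "real n > 2 * \<rho> * real r" and r: "0 < r"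
begin

abbreviation "X \<equiv> torus_verts n :: (int ^ 'd) set"
abbreviation "E \<equiv> torus_edges p \<rho> n :: (int ^ 'd) set set"

sublocale regular_finite_graph X E "torus_degree TYPE('d) p \<rho> n"
proof
  fix e assume "e \<in> E"
  then show "\<exists>x\<in>X. \<exists>y\<in>X. x \<noteq> y \<and> e = {x, y}" by (auto simp: torus_edges_def)
qed (simp_all add: torus_degree_eq[OF p rho n r])

lemma weight_eq: "weight p \<rho> n a b V \<zeta> = set_weight a b (pos_verts V \<zeta>)"
  for V :: "(int ^ 'd) set"
  by (simp add: weight_def perimeter_def set_weight_def edges_in_def)

text \<open>The constant is the Boltzmann weight of the all-minus configuration; it cancels in the
  normalized measure.\<close>

lemma boltzmann_eq:
  assumes "\<sigma> \<in> configs X"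
  shows "boltzmann p \<rho> n a b \<sigma> =
    exp (b * real (card E) - a * real (card X)) * set_weight a b (pos_verts X \<sigma>)"
  unfolding boltzmann_def set_weight_def sum_config[OF assms] sum_edges_prod[OF assms]
  by (simp add: algebra_simps flip: exp_add)

lemma measure_ising:
  assumes "A \<subseteq> configs X"
  shows "measure (ising p \<rho> n a b) A =
    (\<Sum>\<sigma>\<in>A. set_weight a b (pos_verts X \<sigma>)) / (\<Sum>S\<in>Pow X. set_weight a b S)"
proof -
  let ?c = "exp (b * real (card E) - a * real (card X))"
  have Z: "(\<Sum>\<tau>\<in>configs X. boltzmann p \<rho> n a b \<tau>) = ?c * (\<Sum>S\<in>Pow X. set_weight a b S)"
    by (simp add: boltzmann_eq sum_configs_eq_sum_Pow flip: sum_distrib_left)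
  have Z0: "(\<Sum>S\<in>Pow X. set_weight a b S) > 0"
    by (intro sum_pos set_weight_pos) auto
  have "emeasure (ising p \<rho> n a b) A =
      (\<Sum>\<sigma>\<in>A. ennreal (boltzmann p \<rho> n a b \<sigma> / (\<Sum>\<tau>\<in>configs X. boltzmann p \<rho> n a b \<tau>)))"
    unfolding ising_def using assms by (simp add: emeasure_point_measure_finite finite_configs)
  also have "\<dots> = (\<Sum>\<sigma>\<in>A. ennreal (set_weight a b (pos_verts X \<sigma>) / (\<Sum>S\<in>Pow X. set_weight a b S)))"
    unfolding Z using assms by (intro sum.cong) (auto simp: boltzmann_eq)
  also have "\<dots> = ennreal ((\<Sum>\<sigma>\<in>A. set_weight a b (pos_verts X \<sigma>)) / (\<Sum>S\<in>Pow X. set_weight a b S))"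
    using Z0 by (subst sum_ennreal) (auto simp: sum_divide_distrib intro!: divide_nonneg_pos less_imp_le[OF set_weight_pos])
  finally show ?thesis
    using Z0 by (intro measure_eq_emeasure_eq_ennreal)
      (auto intro!: divide_nonneg_pos sum_nonneg less_imp_le[OF set_weight_pos])
qed

text \<open>This is part (1) for a fixed \<open>n\<close>. Times the partition function, the
  probability is a sum over the positive sets outside \<open>V\<close>, to which the key estimate
  applies with \<open>U = X - V\<close>; replacing \<open>X - V\<close> by \<open>X\<close>
  afterwards only adds nonnegative terms.\<close>

lemma measure_ising_local_le:
  assumes "b \<ge> 0" "(1 + 2 * exp (2 * (a + real (torus_degree TYPE('d) p \<rho> n) * b))) ^ torus_degree TYPE('d) p \<rho> n \<le> 2"
    and V: "V \<subseteq> X" "\<zeta> \<in> configs V"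
  shows "measure (ising p \<rho> n a b) {\<sigma> \<in> configs X. config_indicator V \<zeta> \<sigma> = 1}
    \<le> 2 ^ card V * weight p \<rho> n a b V \<zeta>"
proof -
  let ?w = "set_weight a b" and ?A = "pos_verts V \<zeta>"
  let ?Z = "\<lambda>U. \<Sum>S\<in>Pow U. ?w S"
  have w0: "?w S \<ge> 0" for S by (rule less_imp_le[OF set_weight_pos])
  have Z0: "?Z X > 0" by (intro sum_pos set_weight_pos) auto
  have "{\<sigma> \<in> configs X. config_indicator V \<zeta> \<sigma> = 1} = {\<sigma> \<in> configs X. restrict \<sigma> V = \<zeta>}"
    by (auto simp: config_indicator_def)
  then have "measure (ising p \<rho> n a b) {\<sigma> \<in> configs X. config_indicator V \<zeta> \<sigma> = 1} * ?Z X
      = (\<Sum>\<sigma>\<in>{\<sigma> \<in> configs X. restrict \<sigma> V = \<zeta>}. ?w (pos_verts X \<sigma>))"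
    using Z0 by (simp add: measure_ising)
  also have "\<dots> = (\<Sum>S\<in>Pow (X - V). ?w (?A \<union> S))"
    by (rule sum_configs_restrict[OF V])
  also have "\<dots> \<le> 2 ^ card ?A * ?w ?A * ?Z (X - V)"
    using V by (intro sum_set_weight_Un_le assms) (auto simp: pos_verts_def)
  also have "\<dots> \<le> 2 ^ card V * ?w ?A * ?Z X"
  proof (intro mult_mono power_increasing)
    show "card ?A \<le> card V"
      using V finite_subset[OF V(1)] by (intro card_mono) (auto simp: pos_verts_def)
    show "?Z (X - V) \<le> ?Z X" by (intro sum_mono2 w0) auto
  qed (auto intro!: mult_nonneg_nonneg sum_nonneg w0)
  finally show ?thesis using Z0 by (simp add: weight_eq)
qed

section \<open>Local configurations: ratios of weights, a lower bound, and the degree\<close>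

lemma pos_verts_place:
  "pos_verts (torus_ball p \<rho> n 0 r) (place p \<rho> r n \<eta> 0) = wrap n ` pos_verts (local_ball p \<rho> r) \<eta>"
  for \<eta> :: "int ^ 'd \<Rightarrow> real"
proof -
  have 0: "(0 :: int ^ 'd) \<in> X" using n_pos[OF p rho n r] by (simp add: torus_verts_def)
  show ?thesis
    using place_apply(2)[OF p rho n r 0, of _ \<eta>] torus_ball_eq[OF p rho n r 0]
    by (auto simp: pos_verts_def)
qed

lemma local_ball_inj: "inj_on (wrap n) (local_ball p \<rho> r :: (int ^ 'd) set)"
  by (rule bij_betw_imp_inj_on[OF wrap_bij_betw[OF p rho n r]])

lemma finite_local_ball: "finite (local_ball p \<rho> r :: (int ^ 'd) set)"
proof -
  have "finite (torus_ball p \<rho> n (0 :: int ^ 'd) r)"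
    by (rule finite_subset[of _ X]) (auto simp: torus_ball_def graph_ball_def)
  then show ?thesis by (rule bij_betw_finite[OF wrap_bij_betw[OF p rho n r], THEN iffD2])
qed

lemma place_subset: "wrap n ` pos_verts (local_ball p \<rho> r) \<eta> \<subseteq> X" for \<eta> :: "int ^ 'd \<Rightarrow> real"
  using wrap_in_torus[OF n_pos[OF p rho n r]] by auto

lemma local_weight_eq:
  "local_weight p \<rho> r n a b \<eta> = set_weight a b (wrap n ` pos_verts (local_ball p \<rho> r) \<eta>)"
  for \<eta> :: "int ^ 'd \<Rightarrow> real"
  by (simp add: local_weight_def weight_eq pos_verts_place)

text \<open>The probability gap and the maximality probability are both maxima of such ratios. The
  ratio is at most a power of a number at most 1, and the exponent \<open>card L\<close> is at least
  1.\<close>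

lemma set_weight_ratio_bounds:
  assumes "b \<ge> 0" "a + real (torus_degree TYPE('d) p \<rho> n) * b \<le> 0" "A \<subseteq> X" "L \<subseteq> X" "A \<inter> L = {}" "L \<noteq> {}"
  shows "0 \<le> set_weight a b (A \<union> L) / set_weight a b A \<and>
    set_weight a b (A \<union> L) / set_weight a b A \<le> exp (2 * (a + real (torus_degree TYPE('d) p \<rho> n) * b))"
proof -
  let ?x = "exp (2 * (a + real (torus_degree TYPE('d) p \<rho> n) * b))"
  have "finite L" using assms(4) finite_X finite_subset by blast
  then have "card L \<noteq> 0" using assms(6) by simp
  then have "?x ^ card L \<le> ?x ^ 1" using assms(2) by (intro power_decreasing) auto
  then have "set_weight a b A * ?x ^ card L \<le> set_weight a b A * ?x"
    using set_weight_pos[of a b A] by simp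
  with set_weight_Un_le[of A L b a] assms
  have "set_weight a b (A \<union> L) \<le> set_weight a b A * ?x" by auto
  then show ?thesis
    using set_weight_pos[of a b A] set_weight_pos[of a b "A \<union> L"] by (simp add: field_simps)
qed

lemma prob_gap_bounds:
  fixes \<eta> :: "int ^ 'd \<Rightarrow> real"
  assumes "b \<ge> 0" "a + real (torus_degree TYPE('d) p \<rho> n) * b \<le> 0"
  shows "0 \<le> prob_gap p \<rho> r n a b \<eta> \<and> prob_gap p \<rho> r n a b \<eta> \<le> exp (2 * (a + real (torus_degree TYPE('d) p \<rho> n) * b))"
proof -
  let ?B = "torus_ball p \<rho> n (0 :: int ^ 'd) r"
  let ?bd = "torus_boundary p \<rho> n ?B" and ?A = "wrap n ` pos_verts (local_ball p \<rho> r) \<eta>"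
  have sub: "?B \<subseteq> X" "?bd \<subseteq> X" and dj: "?B \<inter> ?bd = {}"
    by (auto simp: torus_boundary_def outer_boundary_def torus_ball_def graph_ball_def)
  have A: "?A \<subseteq> ?B" unfolding pos_verts_place[symmetric] by (auto simp: pos_verts_def)
  show ?thesis unfolding prob_gap_def Let_def
  proof (rule max_or_zero_bounds)
    have "finite ?bd" using sub finite_X finite_subset by blast
    then show "finite ((\<lambda>\<sigma>. weight p \<rho> n a b (?B \<union> ?bd) (merge ?B ?bd (place p \<rho> r n \<eta> 0, \<sigma>))
        / local_weight p \<rho> r n a b \<eta>) ` (configs ?bd - {null_config ?bd}))"
      by (simp add: finite_configs)
  next
    fix t assume "t \<in> (\<lambda>\<sigma>. weight p \<rho> n a b (?B \<union> ?bd) (merge ?B ?bd (place p \<rho> r n \<eta> 0, \<sigma>))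
        / local_weight p \<rho> r n a b \<eta>) ` (configs ?bd - {null_config ?bd})"
    then obtain \<sigma> where \<sigma>: "\<sigma> \<in> configs ?bd" "\<sigma> \<noteq> null_config ?bd"
      and t: "t = set_weight a b (?A \<union> pos_verts ?bd \<sigma>) / set_weight a b ?A"
      by (auto simp: weight_eq local_weight_eq pos_verts_merge[OF dj] pos_verts_place)
    have null: "null_config ?bd \<in> configs ?bd" "pos_verts ?bd (null_config ?bd) = {}"
      by (auto simp: null_config_def configs_def pos_verts_def)
    \<comment> \<open>A configuration is determined by its positive vertices, so one that is not
      null has at least one of them.\<close>
    have "pos_verts ?bd \<sigma> \<noteq> {}" using pos_verts_inj[OF \<sigma>(1) null(1)] \<sigma>(2) null(2) by auto
    moreover have "pos_verts ?bd \<sigma> \<subseteq> ?bd" by (auto simp: pos_verts_def)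
    ultimately show "0 \<le> t \<and> t \<le> exp (2 * (a + real (torus_degree TYPE('d) p \<rho> n) * b))"
      unfolding t using A sub dj by (intro set_weight_ratio_bounds assms) blast+
  qed simp
qed

lemma max_prob_bounds:
  fixes \<eta> :: "int ^ 'd \<Rightarrow> real"
  assumes "b \<ge> 0" "a + real (torus_degree TYPE('d) p \<rho> n) * b \<le> 0" "\<eta> \<in> local_configs p \<rho> r"
  shows "0 \<le> max_prob p \<rho> r n a b \<eta> \<and> max_prob p \<rho> r n a b \<eta> \<le> exp (2 * (a + real (torus_degree TYPE('d) p \<rho> n) * b))"
  unfolding max_prob_def
proof (rule max_or_zero_bounds)
  show "finite ((\<lambda>\<eta>'. local_weight p \<rho> r n a b \<eta>' / local_weight p \<rho> r n a b \<eta>)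
      ` (larger_configs p \<rho> r \<eta> - {\<eta>}))"
    using finite_configs[OF finite_local_ball] by (simp add: larger_configs_def local_configs_def)
next
  let ?P = "pos_verts (local_ball p \<rho> r) :: (int ^ 'd \<Rightarrow> real) \<Rightarrow> _"
  fix t assume "t \<in> (\<lambda>\<eta>'. local_weight p \<rho> r n a b \<eta>' / local_weight p \<rho> r n a b \<eta>)
      ` (larger_configs p \<rho> r \<eta> - {\<eta>})"
  then obtain \<eta>' where \<eta>': "\<eta>' \<in> local_configs p \<rho> r" "?P \<eta> \<subseteq> ?P \<eta>'" "\<eta>' \<noteq> \<eta>"
    and t: "t = set_weight a b (wrap n ` ?P \<eta>') / set_weight a b (wrap n ` ?P \<eta>)"
    by (auto simp: local_weight_eq larger_configs_def)
  let ?L = "wrap n ` (?P \<eta>' - ?P \<eta>)"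
  have "?P \<eta>' \<noteq> ?P \<eta>"
    using pos_verts_inj[of \<eta>' "local_ball p \<rho> r" \<eta>] \<eta>' assms(3) by (auto simp: local_configs_def)
  then have "?L \<noteq> {}" using \<eta>'(2) by auto
  \<comment> \<open>Disjointness survives the passage to the torus because \<open>wrap n\<close> is
    injective on the local ball.\<close>
  moreover have "wrap n ` ?P \<eta> \<inter> ?L = {}"
    using local_ball_inj by (auto simp: pos_verts_def inj_on_def)
  moreover have "wrap n ` ?P \<eta>' = wrap n ` ?P \<eta> \<union> ?L" using \<eta>'(2) by auto
  ultimately show "0 \<le> t \<and> t \<le> exp (2 * (a + real (torus_degree TYPE('d) p \<rho> n) * b))"
    unfolding t using set_weight_ratio_bounds[OF assms(1,2) place_subset[of \<eta>], of ?L]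
      place_subset[of \<eta>'] by auto
qed simp

text \<open>Let \<open>k\<close> be the number of positive vertices and \<open>D\<close> the degree.
  Inner edges only increase the weight, so its exponent is at least
  \<open>2 * a * k - 2 * D * b * k\<close>; the hypothesis bounds \<open>- 2 * D * b\<close> below
  by \<open>a\<close>, which leaves \<open>3 * a * k\<close>.\<close>

lemma local_weight_ge:
  fixes \<eta> :: "int ^ 'd \<Rightarrow> real"
  assumes "b \<ge> 0" "a + 2 * real (torus_degree TYPE('d) p \<rho> n) * b \<le> 0"
  shows "exp a ^ (3 * card (pos_verts (local_ball p \<rho> r) \<eta>)) \<le> local_weight p \<rho> r n a b \<eta>"
proof -
  let ?P = "pos_verts (local_ball p \<rho> r) \<eta>"
  have "card (wrap n ` ?P) = card ?P"
    by (rule card_image[OF inj_on_subset[OF local_ball_inj]]) (auto simp: pos_verts_def)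
  moreover have "(a + 2 * real (torus_degree TYPE('d) p \<rho> n) * b) * real (card ?P) \<le> 0"
    using assms(2) by (intro mult_nonpos_nonneg) auto
  moreover have "b * real (edges_in (wrap n ` ?P)) \<ge> 0" using assms(1) by simp
  ultimately show ?thesis
    by (simp add: local_weight_eq set_weight_def algebra_simps flip: exp_of_nat_mult)
qed

text \<open>The bound is uniform in \<open>n\<close>: neighbours of the origin lift to lattice
  vectors of norm at most \<open>\<rho>\<close>, whose integer coordinates are at most the floor of
  \<open>\<rho>\<close> in absolute value.\<close>

lemma torus_degree_le: "torus_degree TYPE('d) p \<rho> n \<le> card {y :: int ^ 'd. \<forall>i. y $ i \<in> {-\<lfloor>\<rho>\<rfloor>..\<lfloor>\<rho>\<rfloor>}}"
proof -
  let ?K = "{y :: int ^ 'd. \<forall>i. y $ i \<in> {-\<lfloor>\<rho>\<rfloor>..\<lfloor>\<rho>\<rfloor>}}"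
  have "?K \<subseteq> vec_lambda ` (UNIV \<rightarrow>\<^sub>E {-\<lfloor>\<rho>\<rfloor>..\<lfloor>\<rho>\<rfloor>})"
  proof
    fix y assume "y \<in> ?K"
    then show "y \<in> vec_lambda ` (UNIV \<rightarrow>\<^sub>E {-\<lfloor>\<rho>\<rfloor>..\<lfloor>\<rho>\<rfloor>})"
      by (intro image_eqI[where x = "vec_nth y"]) (auto simp: vec_nth_inverse)
  qed
  then have fin: "finite ?K" by (rule finite_subset) (intro finite_imageI finite_PiE, auto)
  have "{w. w \<in> X \<and> {0, w} \<in> E} \<subseteq> wrap n ` ?K"
  proof
    fix w assume "w \<in> {w. w \<in> X \<and> {0, w} \<in> E}"
    moreover have "wrap n (0 :: int ^ 'd) = 0" by (simp add: wrap_def vec_eq_iff)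
    ultimately have "{wrap n 0, w} \<in> E" by simp
    then obtain y where y: "w = wrap n y" "{0, y} \<in> lattice_edges p \<rho>"
      using lattice_edge_lift[OF p rho n r] by blast
    have "\<bar>y $ i\<bar> \<le> \<lfloor>\<rho>\<rfloor>" for i
      using abs_le_lp_norm[OF p, of y i] y(2) by (simp add: lattice_edge_iff le_floor_iff)
    then have "y \<in> ?K" by (simp add: abs_le_iff minus_le_iff)
    then show "w \<in> wrap n ` ?K" using y(1) by blast
  qed
  then show ?thesis unfolding torus_degree_def by (rule surj_card_le[OF fin])
qed

end

section \<open>Limits in \<open>n\<close> and the two assertions\<close>

lemma eventually_inj_on_wrap:
  fixes V :: "(int ^ 'd::finite) set"
  assumes "finite V"
  shows "\<forall>\<^sub>F n in sequentially. inj_on (wrap n) V"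
proof -
  \<comment> \<open>For such \<open>n\<close>, \<open>central_rep n\<close> recovers each point of
    \<open>V\<close> from its image under \<open>wrap n\<close>.\<close>
  have "\<forall>\<^sub>F n in sequentially. \<forall>x\<in>V. \<forall>i. 2 * \<bar>x $ i\<bar> < int n"
  proof (intro eventually_ball_finite assms ballI eventually_all_finite)
    fix x :: "int ^ 'd" and i
    show "\<forall>\<^sub>F n in sequentially. 2 * \<bar>x $ i\<bar> < int n"
      using eventually_gt_at_top[of "nat (2 * \<bar>x $ i\<bar>)"] by eventually_elim linarith
  qed
  then show ?thesis
    by eventually_elim (metis central_rep_small central_rep_cong inj_onI)
qed

theorem proposition3p2:
  fixes p :: ereal and \<rho> lam :: real and r :: nat
    and a b :: "nat \<Rightarrow> real" and \<eta> :: "int ^ 'd::finite \<Rightarrow> real"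
  assumes "1 \<le> p" and "1 \<le> \<rho>" and "0 < r"
    and "\<eta> \<in> local_configs p \<rho> r"
    and "\<And>n. real n > 2 * \<rho> * real r \<Longrightarrow> a n < 0"
    and "\<And>n. real n > 2 * \<rho> * real r \<Longrightarrow> b n \<ge> 0"
    and "lam > 0"
    and "\<And>n. real n > 2 * \<rho> * real r \<Longrightarrow>
           real n ^ CARD('d) * local_weight p \<rho> r n (a n) (b n) \<eta> = lam"
  shows
    "((\<forall>\<^sub>F n in sequentially. a n + 2 * real (torus_degree TYPE('d) p \<rho> n) * b n \<le> 0) \<longrightarrow>
       (\<exists>C :: nat \<Rightarrow> real. (\<forall>k. C k > 0) \<and>
         (\<forall>V :: (int ^ 'd) set. finite V \<longrightarrow>
           (\<exists>N. \<forall>n\<ge>N. inj_on (wrap n) V \<and>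
             (\<forall>\<zeta>\<in>configs (wrap n ` V).
               measure (ising p \<rho> n (a n) (b n))
                 {\<sigma> \<in> configs (torus_verts n). config_indicator (wrap n ` V) \<zeta> \<sigma> = 1}
               \<le> C (card V) * weight p \<rho> n (a n) (b n) (wrap n ` V) \<zeta>))))) \<and>
     (filterlim (\<lambda>n. a n + real (torus_degree TYPE('d) p \<rho> n) * b n) at_bot sequentially \<longrightarrow>
       (\<lambda>n. max (prob_gap p \<rho> r n (a n) (b n) \<eta>) (max_prob p \<rho> r n (a n) (b n) \<eta>))
         \<longlonglongrightarrow> 0)"
proof (intro conjI impI)
  have large: "\<forall>\<^sub>F n in sequentially. real n > 2 * \<rho> * real r"
    using filterlim_real_sequentially by (simp add: filterlim_at_top_dense)
  have torus: "ising_torus p \<rho> r n" if "real n > 2 * \<rho> * real r" for n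
    using that assms(1-3) by (simp add: ising_torus_def)
  {
    assume "\<forall>\<^sub>F n in sequentially. a n + 2 * real (torus_degree TYPE('d) p \<rho> n) * b n \<le> 0"
    with large have ev: "\<forall>\<^sub>F n in sequentially. real n > 2 * \<rho> * real r \<and>
        a n + 2 * real (torus_degree TYPE('d) p \<rho> n) * b n \<le> 0"
      by (rule eventually_conj)
    let ?k = "card (pos_verts (local_ball p \<rho> r) \<eta>)"
    let ?K = "card {y :: int ^ 'd. \<forall>i. y $ i \<in> {-\<lfloor>\<rho>\<rfloor>..\<lfloor>\<rho>\<rfloor>}}"
    \<comment> \<open>The power is at most the weight of \<open>\<eta>\<close>, which the
      normalization forces to be \<open>lam / real n ^ CARD('d)\<close>.\<close>
    have pow: "(\<lambda>n. exp (a n) ^ (3 * ?k)) \<longlonglongrightarrow> 0"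
    proof (rule tendsto_sandwich[OF _ _ tendsto_const])
      show "\<forall>\<^sub>F n in sequentially. exp (a n) ^ (3 * ?k) \<le> lam / real n ^ CARD('d)"
        using ev eventually_gt_at_top[of 0]
      proof eventually_elim
        case (elim n)
        interpret ising_torus "TYPE('d)" p \<rho> r n using elim by (simp add: torus)
        have "exp (a n) ^ (3 * ?k) \<le> local_weight p \<rho> r n (a n) (b n) \<eta>"
          using elim assms(6) by (intro local_weight_ge) auto
        also have "\<dots> = lam / real n ^ CARD('d)" using assms(8)[of n] elim by (simp add: field_simps)
        finally show ?case .
      qed
      show "(\<lambda>n. lam / real n ^ CARD('d)) \<longlonglongrightarrow> 0"
        by (intro tendsto_divide_0[OF tendsto_const] filterlim_at_top_imp_at_infinity
            filterlim_pow_at_top filterlim_real_sequentially) simp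
    qed simp
    \<comment> \<open>For a null \<open>\<eta>\<close> the power would be constantly 1. Since
      \<open>?k\<close> is positive, the root of order \<open>3 * ?k\<close> can be taken.\<close>
    have "?k \<noteq> 0"
    proof
      assume "?k = 0"
      with pow have "(\<lambda>n::nat. 1 :: real) \<longlonglongrightarrow> 0" by simp
      then show False by (simp add: LIMSEQ_const_iff)
    qed
    then have "3 * ?k > 0" by simp
    from tendsto_real_root[OF pow, of "3 * ?k"] have "(\<lambda>n. exp (a n)) \<longlonglongrightarrow> 0"
      unfolding real_root_zero real_root_power_cancel[OF \<open>3 * ?k > 0\<close> exp_ge_zero] .
    then have "(\<lambda>n. (1 + 2 * exp (a n)) ^ ?K) \<longlonglongrightarrow> (1 + 2 * 0) ^ ?K"
      by (intro tendsto_intros)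
    \<comment> \<open>The exponent \<open>?K\<close> does not vary with \<open>n\<close>, so the
      limit is 1.\<close>
    then have "\<forall>\<^sub>F n in sequentially. (1 + 2 * exp (a n)) ^ ?K < 2"
      by (rule order_tendstoD) simp
    with ev have small: "\<forall>\<^sub>F n in sequentially. real n > 2 * \<rho> * real r \<and>
      (1 + 2 * exp (2 * (a n + real (torus_degree TYPE('d) p \<rho> n) * b n))) ^ torus_degree TYPE('d) p \<rho> n \<le> 2"
    proof eventually_elim
      case (elim n)
      interpret ising_torus "TYPE('d)" p \<rho> r n using elim by (simp add: torus)
      \<comment> \<open>With \<open>D\<close> the degree, \<open>2 * (a n + D * b n)\<close> is
        \<open>a n\<close> plus \<open>a n + 2 * D * b n\<close>, and the latter is at most
        0.\<close>
      have "(1 + 2 * exp (2 * (a n + real (torus_degree TYPE('d) p \<rho> n) * b n))) ^ torus_degree TYPE('d) p \<rho> n \<le> (1 + 2 * exp (a n)) ^ torus_degree TYPE('d) p \<rho> n"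
        using elim by (intro power_mono) (auto simp: algebra_simps)
      also have "\<dots> \<le> (1 + 2 * exp (a n)) ^ ?K"
        by (intro power_increasing torus_degree_le) simp
      finally show ?case using elim by simp
    qed
    have "\<exists>N. \<forall>n\<ge>N. inj_on (wrap n) V \<and>
             (\<forall>\<zeta>\<in>configs (wrap n ` V).
               measure (ising p \<rho> n (a n) (b n))
                 {\<sigma> \<in> configs (torus_verts n). config_indicator (wrap n ` V) \<zeta> \<sigma> = 1}
               \<le> 2 ^ card V * weight p \<rho> n (a n) (b n) (wrap n ` V) \<zeta>)"
      if "finite V" for V :: "(int ^ 'd) set"
      unfolding eventually_sequentially[symmetric]
      using small eventually_inj_on_wrap[OF that]
    proof eventually_elim
      case (elim n)
      interpret ising_torus "TYPE('d)" p \<rho> r n using elim by (simp add: torus)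
      have "wrap n ` V \<subseteq> X" using wrap_in_torus[OF n_pos[OF p rho n r]] by auto
      then show ?case
        using elim assms(6)[of n] measure_ising_local_le[of "b n" "a n" "wrap n ` V"]
        by (simp add: card_image)
    qed
    then show "\<exists>C :: nat \<Rightarrow> real. (\<forall>k. C k > 0) \<and>
         (\<forall>V :: (int ^ 'd) set. finite V \<longrightarrow>
           (\<exists>N. \<forall>n\<ge>N. inj_on (wrap n) V \<and>
             (\<forall>\<zeta>\<in>configs (wrap n ` V).
               measure (ising p \<rho> n (a n) (b n))
                 {\<sigma> \<in> configs (torus_verts n). config_indicator (wrap n ` V) \<zeta> \<sigma> = 1}
               \<le> C (card V) * weight p \<rho> n (a n) (b n) (wrap n ` V) \<zeta>)))"
      by (intro exI[of _ "\<lambda>k. 2 ^ k"]) simp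
  next
    let ?s = "\<lambda>n. a n + real (torus_degree TYPE('d) p \<rho> n) * b n"
    assume lim: "filterlim ?s at_bot sequentially"
    have bounds: "\<forall>\<^sub>F n in sequentially.
        0 \<le> max (prob_gap p \<rho> r n (a n) (b n) \<eta>) (max_prob p \<rho> r n (a n) (b n) \<eta>) \<and>
        max (prob_gap p \<rho> r n (a n) (b n) \<eta>) (max_prob p \<rho> r n (a n) (b n) \<eta>) \<le> exp (2 * ?s n)"
      \<comment> \<open>The threshold 0 supplies the sign condition on \<open>?s n\<close> that both
        bounds require.\<close>
      using large filterlim_at_bot[THEN iffD1, OF lim, rule_format, of 0]
    proof eventually_elim
      case (elim n)
      interpret ising_torus "TYPE('d)" p \<rho> r n using elim by (simp add: torus)
      show ?case
        using prob_gap_bounds[of "b n" "a n" \<eta>] max_prob_bounds[of "b n" "a n" \<eta>] elim assms(4,6)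
        by (simp add: le_max_iff_disj)
    qed
    have "(\<lambda>n. exp (?s n)) \<longlonglongrightarrow> 0" by (rule filterlim_compose[OF exp_at_bot lim])
    then have "(\<lambda>n. exp (?s n) ^ 2) \<longlonglongrightarrow> 0 ^ 2" by (rule tendsto_power)
    then have upper: "(\<lambda>n. exp (2 * ?s n)) \<longlonglongrightarrow> 0" unfolding exp_double by simp
    show "(\<lambda>n. max (prob_gap p \<rho> r n (a n) (b n) \<eta>) (max_prob p \<rho> r n (a n) (b n) \<eta>))
        \<longlonglongrightarrow> 0"
      by (rule tendsto_sandwich[OF bounds[unfolded eventually_conj_iff, THEN conjunct1]
            bounds[unfolded eventually_conj_iff, THEN conjunct2] tendsto_const upper])
  }
qed

end
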